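(* Let $\mathcal{H}$ be a real Hilbert space, let $C$ be a nonempty closed convex subset of $\mathcal{H}$, let $\phi\colon\mathbb{R}\to\mathbb{R}$ be an even convex function which is differentiable on $\mathbb{R}\smallsetminus\{0\}$, and set $f=\phi\circ d_C$. Then $$(\forall x\in\mathcal{H})\quad\operatorname{prox}_f x=\begin{cases}x+\dfrac{\operatorname{prox}_{\phi^*}d_C(x)}{d_C(x)}(P_Cx-x),&\text{if } d_C(x)>\max\partial\phi(0);\\[2mm] P_Cx,&\text{if } d_C(x)\leq\max\partial\phi(0).\end{cases}$$
   Context: $d_C(x)=\inf_{y\in C}\|x-y\|$ is the distance function to $C$ and $P_Cx$ is the projection of $x$ onto $C$, i.e. the unique point of $C$ with $\|x-P_Cx\|=d_C(x)$. $\phi^*\colon u\mapsto\sup_{t\in\mathbb{R}}(tu-\phi(t))$ is the conjugate of $\phi$, and $\partial\phi(0)$ is the (convex-analysis) subdifferential of $\phi$ at $0$. For a proper lower semicontinuous convex function $g$ from a real Hilbert space to $]-\infty,+\infty]$, the proximity operator $\operatorname{prox}_g$ maps $x$ to the unique minimizer over $y$ of $g(y)+\frac12\|x-y\|^2$. *)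

theory Defs
  imports "HOL-Analysis.Analysis"
begin

(* Not closest_point from the library: that one needs the Heine-Borel property,
   i.e. finite dimension. *)
definition projection :: "'a::real_inner set \<Rightarrow> 'a \<Rightarrow> 'a"
  where "projection C x = (THE p. p \<in> C \<and> norm (x - p) = infdist x C)"

(* Extended-real-valued: the supremum can be \<infinity> even for real-valued phi. *)
definition convex_conjugate :: "(real \<Rightarrow> real) \<Rightarrow> real \<Rightarrow> ereal"
  where "convex_conjugate \<phi> u = (SUP t. ereal (t * u - \<phi> t))"

definition subdifferential :: "('a::real_inner \<Rightarrow> real) \<Rightarrow> 'a \<Rightarrow> 'a set"
  where "subdifferential g x = {u. \<forall>y. inner (y - x) u + g x \<le> g y}"

(* Meaningful for proper lower semicontinuous convex g on a Hilbert space, where the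
   minimizer exists and is unique. *)
definition prox :: "('a::real_inner \<Rightarrow> ereal) \<Rightarrow> 'a \<Rightarrow> 'a"
  where "prox g x =
    (THE p. \<forall>y. g p + ereal ((norm (x - p))\<^sup>2 / 2) \<le> g y + ereal ((norm (x - y))\<^sup>2 / 2))"

end

theory Submission
  imports Defs
begin

text \<open>
  Everything rests on Fermat's rule: for convex \<open>g\<close>, \<open>p = prox g x\<close> if and only if \<open>x - p\<close> is a
  subgradient of \<open>g\<close> at \<open>p\<close>. Write \<open>d\<close> for the distance from \<open>x\<close> to \<open>C\<close> and suppose that \<open>d = u + p\<close>, where
  \<open>u, p \<ge> 0\<close> and \<open>u\<close> is a subgradient of \<open>\<phi>\<close> at \<open>p\<close>; that is, \<open>p\<close> is the proximal point of \<open>d\<close>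
  for \<open>\<phi>\<close>. Move from \<open>x\<close> towards its projection by the length \<open>u\<close>. The point reached
  lies at distance \<open>p\<close> from \<open>C\<close>, and the hyperplane that separates \<open>C\<close> from \<open>x\<close> bounds the distance
  function from below by an affine function with unit gradient. Composing this bound with the
  subgradient inequality of \<open>\<phi>\<close> shows that \<open>x\<close> minus the point reached, a vector of length \<open>u\<close>,
  is a subgradient of \<open>\<phi> \<circ> d\<^sub>C\<close> at that point, so the point reached is the proximal point
  (\<open>prox_comp_infdist\<close>).

  It remains to decompose \<open>d\<close>. Since \<open>\<phi>\<close> is even and convex, \<open>\<partial>\<phi>(0)\<close> is a compact interval
  symmetric about \<open>0\<close>, and \<open>d \<le> max \<partial>\<phi>(0)\<close> says that \<open>d\<close> lies in it: then \<open>u = d\<close>,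
  \<open>p = 0\<close> works and the point reached is the projection. Otherwise minimizing
  \<open>\<phi>(t) + (d - t)\<^sup>2/2\<close> over \<open>t\<close> supplies \<open>p\<close>, and \<open>u\<close> is identified by Moreau's decomposition
  \<open>d = prox \<phi> d + prox \<phi>\<^sup>* d\<close>, the one-dimensional case of which follows from
  Fermat's rule applied to \<open>\<phi>\<^sup>*\<close>.
\<close>

section \<open>Proximal points and subgradients\<close>

text \<open>
  Expanding \<open>\<parallel>x - y\<parallel>\<^sup>2\<close> around \<open>p\<close> cancels the linear term of the subgradient inequality, so the
  objective at \<open>y\<close> exceeds its value at \<open>p\<close> by at least \<open>\<parallel>y - p\<parallel>\<^sup>2/2\<close>. This gives minimality and
  uniqueness at once.
\<close>

lemma prox_eqI:
  fixes g :: "'a::real_inner \<Rightarrow> ereal"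
  assumes gp: "g p = ereal a"
    and sub: "\<And>y. ereal (a + inner (y - p) (x - p)) \<le> g y"
  shows "prox g x = p"
proof -
  have growth: "ereal (a + (norm (x - p))\<^sup>2 / 2 + (norm (y - p))\<^sup>2 / 2)
      \<le> g y + ereal ((norm (x - y))\<^sup>2 / 2)" for y
  proof -
    have "(norm (x - y))\<^sup>2 = (norm (x - p))\<^sup>2 - 2 * inner (y - p) (x - p) + (norm (y - p))\<^sup>2"
      by (simp add: power2_norm_eq_inner algebra_simps inner_commute)
    then have "ereal (a + (norm (x - p))\<^sup>2 / 2 + (norm (y - p))\<^sup>2 / 2)
        = ereal (a + inner (y - p) (x - p)) + ereal ((norm (x - y))\<^sup>2 / 2)"
      by (simp add: field_simps)
    also have "\<dots> \<le> g y + ereal ((norm (x - y))\<^sup>2 / 2)"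
      by (intro add_right_mono sub)
    finally show ?thesis .
  qed
  show ?thesis
    unfolding prox_def
  proof (rule the_equality)
    show "\<forall>y. g p + ereal ((norm (x - p))\<^sup>2 / 2) \<le> g y + ereal ((norm (x - y))\<^sup>2 / 2)"
    proof
      fix y
      have "g p + ereal ((norm (x - p))\<^sup>2 / 2)
          \<le> ereal (a + (norm (x - p))\<^sup>2 / 2 + (norm (y - p))\<^sup>2 / 2)"
        by (simp add: gp)
      then show "g p + ereal ((norm (x - p))\<^sup>2 / 2) \<le> g y + ereal ((norm (x - y))\<^sup>2 / 2)"
        using growth order_trans by blast
    qed
  next
    fix q
    assume "\<forall>y. g q + ereal ((norm (x - q))\<^sup>2 / 2) \<le> g y + ereal ((norm (x - y))\<^sup>2 / 2)"
    then have "ereal (a + (norm (x - p))\<^sup>2 / 2 + (norm (q - p))\<^sup>2 / 2)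
        \<le> g p + ereal ((norm (x - p))\<^sup>2 / 2)"
      using growth[of q] order_trans by blast
    then show "q = p"
      by (simp add: gp)
  qed
qed

text \<open>
  The converse of \<open>prox_eqI\<close> for convex functions: compare \<open>p\<close> with \<open>p + e (y - p)\<close>. After
  division by \<open>e\<close>, the quadratic term leaves only an error of order \<open>e\<close>.
\<close>

lemma prox_minimizer_subgradient:
  fixes g :: "'a::real_inner \<Rightarrow> real"
  assumes conv: "convex_on UNIV g"
    and min: "\<And>y. g p + (norm (x - p))\<^sup>2 / 2 \<le> g y + (norm (x - y))\<^sup>2 / 2"
  shows "x - p \<in> subdifferential g p"
proof -
  have "inner (y - p) (x - p) + g p \<le> g y" for y
  proof -
    let ?gap = "\<lambda>e. inner (y - p) (x - p) + g p - g y - e * ((norm (y - p))\<^sup>2 / 2)"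
    have gap: "?gap e \<le> 0" if e: "0 < e" "e < 1" for e
    proof -
      let ?z = "(1 - e) *\<^sub>R p + e *\<^sub>R y"
      have "g ?z \<le> (1 - e) * g p + e * g y"
        using convex_onD[OF conv, of e p y] e by simp
      moreover have "g p + (norm (x - p))\<^sup>2 / 2 \<le> g ?z + (norm (x - ?z))\<^sup>2 / 2"
        by (rule min)
      moreover have "(norm (x - ?z))\<^sup>2
          = (norm (x - p))\<^sup>2 - 2 * e * inner (y - p) (x - p) + e\<^sup>2 * (norm (y - p))\<^sup>2"
      proof -
        have "x - ?z = (x - p) - e *\<^sub>R (y - p)"
          by (simp add: algebra_simps)
        then show ?thesis
          unfolding power2_norm_eq_inner
          by (simp add: inner_diff_left inner_diff_right inner_commute power2_eq_square
              algebra_simps)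
      qed
      ultimately have "e * ?gap e \<le> 0"
        by (simp add: algebra_simps power2_eq_square)
      then show ?thesis
        using e by (simp add: mult_le_0_iff)
    qed
    have "eventually (\<lambda>e. ?gap e \<le> 0) (at_right 0)"
      unfolding eventually_at_right_field using gap by (intro exI[of _ 1]) auto
    moreover have "(?gap \<longlongrightarrow> ?gap 0) (at_right 0)"
      by (intro tendsto_intros)
    ultimately have "?gap 0 \<le> 0"
      by (intro tendsto_upperbound[of ?gap]) auto
    then show ?thesis
      by simp
  qed
  then show ?thesis
    by (simp add: subdifferential_def)
qed

text \<open>
  Moreau's decomposition in one dimension. The Fenchel equality \<open>\<phi>\<^sup>*(u) = p u - \<phi>(p)\<close> and the
  inequality \<open>\<phi>\<^sup>*(v) \<ge> p v - \<phi>(p)\<close> say that \<open>p\<close> is a subgradient of \<open>\<phi>\<^sup>*\<close> at \<open>u\<close>.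
\<close>

lemma prox_convex_conjugate:
  assumes u: "u \<in> subdifferential \<phi> p"
  shows "prox (convex_conjugate \<phi>) (u + p) = u"
proof (rule prox_eqI)
  show "convex_conjugate \<phi> u = ereal (p * u - \<phi> p)"
    unfolding convex_conjugate_def
  proof (rule SUP_eqI)
    show "ereal (t * u - \<phi> t) \<le> ereal (p * u - \<phi> p)" for t
      using u by (simp add: subdifferential_def algebra_simps)
  next
    fix b
    assume "\<And>t. t \<in> UNIV \<Longrightarrow> ereal (t * u - \<phi> t) \<le> b"
    then show "ereal (p * u - \<phi> p) \<le> b"
      by blast
  qed
next
  fix v
  have "ereal (p * v - \<phi> p) \<le> convex_conjugate \<phi> v"
    unfolding convex_conjugate_def by (rule SUP_upper) simp
  then show "ereal (p * u - \<phi> p + inner (v - u) (u + p - u)) \<le> convex_conjugate \<phi> v"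
    by (simp add: algebra_simps)
qed

section \<open>Projection onto a closed convex set\<close>

text \<open>
  By the parallelogram law and because the midpoint of two points of \<open>C\<close> is again in \<open>C\<close>, almost
  nearest points lie close together; hence a minimizing sequence is Cauchy.
\<close>

lemma norm_diff_near_points:
  fixes C :: "'a::real_inner set"
  assumes "convex C" and b: "b \<in> C" and c: "c \<in> C"
    and "norm (x - b) \<le> r" and "norm (x - c) \<le> r"
  shows "(norm (b - c))\<^sup>2 \<le> 4 * (r\<^sup>2 - (infdist x C)\<^sup>2)"
proof -
  define m where "m = (1/2) *\<^sub>R b + (1/2) *\<^sub>R c"
  have "m \<in> C"
    unfolding m_def using convexD[OF \<open>convex C\<close> b c, of "1/2" "1/2"] by simp
  then have "infdist x C \<le> norm (x - m)"
    by (metis dist_norm infdist_le)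
  then have near: "(infdist x C)\<^sup>2 \<le> (norm (x - m))\<^sup>2"
    by (intro power_mono infdist_nonneg)
  have "(norm (b - c))\<^sup>2
      = 2 * (norm (x - b))\<^sup>2 + 2 * (norm (x - c))\<^sup>2 - 4 * (norm (x - m))\<^sup>2"
    unfolding power2_norm_eq_inner m_def by (simp add: algebra_simps inner_commute)
  moreover have "(norm (x - b))\<^sup>2 \<le> r\<^sup>2" "(norm (x - c))\<^sup>2 \<le> r\<^sup>2"
    using assms by (auto intro: power_mono)
  ultimately show ?thesis
    using near by argo
qed

lemma nearest_point_exists:
  fixes C :: "'a::{real_inner, complete_space} set"
  assumes "C \<noteq> {}" and "closed C" and "convex C"
  obtains p where "p \<in> C" and "norm (x - p) = infdist x C"
proof -
  let ?d = "infdist x C"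
  have "\<exists>c\<in>C. norm (x - c) < ?d + 1 / real (Suc n)" for n
  proof -
    have "(INF a\<in>C. dist x a) < ?d + 1 / real (Suc n)"
      using infdist_notempty[OF \<open>C \<noteq> {}\<close>, of x] by simp
    moreover have "bdd_below (dist x ` C)"
      by (rule bdd_belowI2[of _ 0]) simp
    ultimately show ?thesis
      using \<open>C \<noteq> {}\<close> by (simp add: cINF_less_iff dist_norm)
  qed
  then obtain c where c: "\<And>n. c n \<in> C" "\<And>n. norm (x - c n) < ?d + 1 / real (Suc n)"
    by metis
  have lim: "(\<lambda>n. norm (x - c n)) \<longlonglongrightarrow> ?d"
  proof (rule tendsto_sandwich)
    show "\<forall>\<^sub>F n in sequentially. ?d \<le> norm (x - c n)"
      using infdist_le[OF c(1), of x] by (simp add: dist_norm)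
    show "\<forall>\<^sub>F n in sequentially. norm (x - c n) \<le> ?d + 1 / real (Suc n)"
      using c(2) less_imp_le by (intro always_eventually) blast
    show "(\<lambda>n. ?d + 1 / real (Suc n)) \<longlonglongrightarrow> ?d"
      using tendsto_add[OF tendsto_const LIMSEQ_inverse_real_of_nat, of ?d]
      by (simp add: inverse_eq_divide)
  qed auto
  have "Cauchy c"
  proof (rule metric_CauchyI)
    fix e :: real
    assume e: "0 < e"
    \<comment> \<open>This radius makes the bound of the previous lemma equal to \<open>e\<^sup>2/2\<close>.\<close>
    define r where "r = sqrt (?d\<^sup>2 + e\<^sup>2 / 8)"
    have r2: "r\<^sup>2 = ?d\<^sup>2 + e\<^sup>2 / 8"
      unfolding r_def by simp
    have "?d < r"
      unfolding r_def by (rule real_less_rsqrt) (use e in simp)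
    then obtain N where N: "\<And>n. n \<ge> N \<Longrightarrow> norm (x - c n) < r"
      using order_tendstoD(2)[OF lim] unfolding eventually_sequentially by blast
    have "dist (c m) (c n) < e" if "m \<ge> N" "n \<ge> N" for m n
    proof -
      have "(norm (c m - c n))\<^sup>2 \<le> 4 * (r\<^sup>2 - ?d\<^sup>2)"
        using N[OF that(1)] N[OF that(2)]
        by (intro norm_diff_near_points \<open>convex C\<close> c(1)) auto
      also have "\<dots> < e\<^sup>2"
        using e by (simp add: r2)
      finally show ?thesis
        using e by (simp add: dist_norm power2_less_imp_less)
    qed
    then show "\<exists>N. \<forall>m\<ge>N. \<forall>n\<ge>N. dist (c m) (c n) < e"
      by blast
  qed
  then obtain p where p: "c \<longlonglongrightarrow> p"
    using Cauchy_convergent_iff convergent_def by blast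
  show thesis
  proof
    show "p \<in> C"
      using closed_sequentially[OF \<open>closed C\<close> c(1) p] .
    have "(\<lambda>n. norm (x - c n)) \<longlonglongrightarrow> norm (x - p)"
      by (intro tendsto_intros p)
    then show "norm (x - p) = ?d"
      using lim LIMSEQ_unique by blast
  qed
qed

lemma
  fixes C :: "'a::{real_inner, complete_space} set"
  assumes "C \<noteq> {}" and "closed C" and "convex C"
  shows projection_in_set: "projection C x \<in> C"
    and norm_diff_projection: "norm (x - projection C x) = infdist x C"
proof -
  have "\<exists>!p. p \<in> C \<and> norm (x - p) = infdist x C"
  proof (rule ex_ex1I)
    show "\<exists>p. p \<in> C \<and> norm (x - p) = infdist x C"
      using nearest_point_exists[OF assms] by blast
  next
    fix p q
    assume "p \<in> C \<and> norm (x - p) = infdist x C" and "q \<in> C \<and> norm (x - q) = infdist x C"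
    then have "(norm (p - q))\<^sup>2 \<le> 4 * ((infdist x C)\<^sup>2 - (infdist x C)\<^sup>2)"
      by (intro norm_diff_near_points \<open>convex C\<close>) auto
    then show "p = q"
      by simp
  qed
  from theI'[OF this]
  show "projection C x \<in> C" and "norm (x - projection C x) = infdist x C"
    unfolding projection_def by auto
qed

lemma inner_projection_le:
  fixes C :: "'a::{real_inner, complete_space} set"
  assumes "C \<noteq> {}" and "closed C" and "convex C" and "c \<in> C"
  shows "inner (x - projection C x) (c - projection C x) \<le> 0"
proof (rule any_closest_point_dot)
  show "\<forall>z\<in>C. dist x (projection C x) \<le> dist x z"
    using norm_diff_projection[OF assms(1-3), of x] infdist_le
    by (metis dist_norm)
qed (use assms projection_in_set[OF assms(1-3)] in auto)

text \<open>
  The half-space through the projection with outer normal \<open>x - P\<^sub>C x\<close> contains \<open>C\<close>, so the signed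
  distance to it is a lower bound for the distance to \<open>C\<close>. The inequality is multiplied by the
  length of the normal in order to cover \<open>x \<in> C\<close>.
\<close>

lemma inner_le_infdist:
  fixes C :: "'a::{real_inner, complete_space} set"
  assumes C: "C \<noteq> {}" "closed C" "convex C"
  shows "inner (y - projection C x) (x - projection C x) \<le> infdist x C * infdist y C"
proof -
  obtain c where c: "c \<in> C" "norm (y - c) = infdist y C"
    using nearest_point_exists[OF C] .
  have "inner (y - projection C x) (x - projection C x)
      = inner (x - projection C x) (c - projection C x) + inner (x - projection C x) (y - c)"
    by (simp add: algebra_simps inner_commute)
  also have "\<dots> \<le> inner (x - projection C x) (y - c)"
    using inner_projection_le[OF C c(1), of x] by simp
  also have "\<dots> \<le> norm (x - projection C x) * norm (y - c)"
    by (rule norm_cauchy_schwarz)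
  finally show ?thesis
    by (simp add: c norm_diff_projection[OF C])
qed

section \<open>Composition with the distance function\<close>

text \<open>
  Let \<open>z\<close> be the point on the right. On the segment from \<open>x\<close> to its projection the bound of
  \<open>inner_le_infdist\<close> is an equality, so \<open>d\<^sub>C(z) = p\<close>; relative to \<open>z\<close> the bound reads
  \<open>d\<^sub>C(y) \<ge> p + \<langle>y - z, e\<rangle>\<close> with the unit normal \<open>e\<close>. Since \<open>u \<ge> 0\<close>, inserting this into
  \<open>\<phi>(s) \<ge> \<phi>(p) + u (s - p)\<close> at \<open>s = d\<^sub>C(y)\<close> shows that \<open>x - z = u e\<close> is a subgradient of the
  composition at \<open>z\<close>. If \<open>x \<in> C\<close>, then \<open>u = p = 0\<close> and \<open>z = x\<close>.
\<close>

lemma prox_comp_infdist: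
  fixes C :: "'a::{real_inner, complete_space} set"
  assumes C: "C \<noteq> {}" "closed C" "convex C"
    and u: "u \<in> subdifferential \<phi> p" "0 \<le> u" and "0 \<le> p" and d: "infdist x C = u + p"
  shows "prox (\<lambda>y. ereal (\<phi> (infdist y C))) x
    = x + (u / infdist x C) *\<^sub>R (projection C x - x)"
proof -
  let ?P = "projection C x" and ?d = "infdist x C"
  define w where "w = x - ?P"
  have norm_w: "norm w = ?d"
    unfolding w_def by (rule norm_diff_projection[OF C])
  define z where "z = x - (u / ?d) *\<^sub>R w"
  have diff_z: "x - z = (u / ?d) *\<^sub>R w"
    by (simp add: z_def)
  have dist_z: "infdist z C = p"
  proof (cases "?d = 0")
    case True
    then have "p = 0" "w = 0"
      using u(2) \<open>0 \<le> p\<close> d norm_w by auto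
    then show ?thesis
      using True by (simp add: z_def)
  next
    case False
    then have "0 < ?d"
      using infdist_nonneg[of x C] by simp
    have zP: "z - ?P = (p / ?d) *\<^sub>R w"
    proof -
      have "z - ?P = (1 - u / ?d) *\<^sub>R w"
        by (simp add: z_def w_def algebra_simps)
      also have "1 - u / ?d = p / ?d"
        using \<open>0 < ?d\<close> d by (simp add: field_simps)
      finally show ?thesis .
    qed
    have "infdist z C \<le> norm (z - ?P)"
      using infdist_le[OF projection_in_set[OF C]] by (metis dist_norm)
    also have "\<dots> = p"
      using \<open>0 < ?d\<close> \<open>0 \<le> p\<close> by (simp add: zP norm_w)
    finally have "infdist z C \<le> p" .
    moreover have "?d * p \<le> ?d * infdist z C"
    proof -
      have "?d * p = inner (z - ?P) w"
        using \<open>0 < ?d\<close> by (simp add: zP norm_w power2_eq_square flip: power2_norm_eq_inner)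
      then show ?thesis
        using inner_le_infdist[OF C, of z x] by (simp add: w_def)
    qed
    ultimately show ?thesis
      using \<open>0 < ?d\<close> by simp
  qed
  have "\<phi> p + inner (y - z) (x - z) \<le> \<phi> (infdist y C)" for y
  proof -
    have "inner (y - z) (x - z) \<le> u * (infdist y C - p)"
    proof (cases "?d = 0")
      case True
      then have "u = 0"
        using u(2) \<open>0 \<le> p\<close> d by simp
      then show ?thesis
        by (simp add: diff_z)
    next
      case False
      then have "0 < ?d"
        using infdist_nonneg[of x C] by simp
      have "inner (y - z) w = inner (y - ?P) w - ?d * p"
      proof -
        have "y - z = (y - ?P) - (1 - u / ?d) *\<^sub>R w"
          by (simp add: z_def w_def algebra_simps)
        then have "inner (y - z) w = inner (y - ?P) w - (1 - u / ?d) * ?d\<^sup>2"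
          unfolding norm_w[symmetric] power2_norm_eq_inner
          by (simp only: inner_diff_left inner_scaleR_left)
        also have "(1 - u / ?d) * ?d\<^sup>2 = ?d * (?d - u)"
          using \<open>0 < ?d\<close> by (simp add: right_diff_distrib left_diff_distrib power2_eq_square)
        finally show ?thesis
          by (simp add: d)
      qed
      then have "inner (y - z) w \<le> ?d * (infdist y C - p)"
        using inner_le_infdist[OF C, of y x] by (simp add: w_def algebra_simps)
      then have "(u / ?d) * inner (y - z) w \<le> (u / ?d) * (?d * (infdist y C - p))"
        using \<open>0 < ?d\<close> u(2) by (intro mult_left_mono) auto
      then show ?thesis
        using \<open>0 < ?d\<close> by (simp add: diff_z)
    qed
    moreover have "(infdist y C - p) * u + \<phi> p \<le> \<phi> (infdist y C)"
      using u(1) by (simp add: subdifferential_def)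
    ultimately show ?thesis
      by (simp add: mult.commute)
  qed
  then have "prox (\<lambda>y. ereal (\<phi> (infdist y C))) x = z"
    by (intro prox_eqI[where a = "\<phi> p"]) (simp_all add: dist_z)
  then show ?thesis
    by (simp add: z_def w_def algebra_simps)
qed

section \<open>Even convex functions on the line\<close>

lemma even_convex_zero_le:
  fixes \<phi> :: "real \<Rightarrow> real"
  assumes even: "\<And>t. \<phi> (- t) = \<phi> t" and conv: "convex_on UNIV \<phi>"
  shows "\<phi> 0 \<le> \<phi> t"
  using convex_onD[OF conv, of "1/2" t "- t"] by (simp add: even)

text \<open>
  The maximum is attained because the subdifferential is closed, contains \<open>0\<close>, and is bounded above
  by the subgradient inequality at \<open>1\<close>. The slopes between \<open>0\<close> and the maximum are subgradients too,
  since both of these are.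
\<close>

lemma le_Greatest_subdifferential_zero:
  fixes \<phi> :: "real \<Rightarrow> real"
  assumes even: "\<And>t. \<phi> (- t) = \<phi> t" and conv: "convex_on UNIV \<phi>"
  defines "m \<equiv> (GREATEST u. u \<in> subdifferential \<phi> 0)"
  assumes "0 \<le> d" and "d \<le> m"
  shows "d \<in> subdifferential \<phi> 0"
proof -
  let ?S = "subdifferential \<phi> 0"
  have S: "?S = (\<Inter>y. {u. y * u + \<phi> 0 \<le> \<phi> y})"
    by (auto simp: subdifferential_def)
  have "closed ?S"
    unfolding S by (intro closed_INT ballI closed_Collect_le continuous_intros)
  moreover have "0 \<in> ?S"
    using even_convex_zero_le[OF even conv] by (simp add: subdifferential_def)
  moreover have bdd: "bdd_above ?S"
  proof
    fix u
    assume "u \<in> ?S"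
    then have "1 * u + \<phi> 0 \<le> \<phi> 1"
      unfolding S by blast
    then show "u \<le> \<phi> 1 - \<phi> 0"
      by simp
  qed
  ultimately have Sup: "Sup ?S \<in> ?S"
    by (intro closed_contains_Sup) auto
  then have m: "m = Sup ?S"
    unfolding m_def by (rule Greatest_equality) (rule cSup_upper[OF _ bdd])
  have "y * d + \<phi> 0 \<le> \<phi> y" for y
  proof (cases "0 \<le> y")
    case True
    then have "y * d \<le> y * m"
      using \<open>d \<le> m\<close> by (simp add: mult_left_mono)
    moreover have "y * m + \<phi> 0 \<le> \<phi> y"
      using Sup unfolding m by (simp add: subdifferential_def)
    ultimately show ?thesis
      by linarith
  next
    case False
    then have "y * d \<le> 0"
      using \<open>0 \<le> d\<close> by (simp add: mult_nonpos_nonneg)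
    then show ?thesis
      using even_convex_zero_le[OF even conv, of y] by linarith
  qed
  then show ?thesis
    by (simp add: subdifferential_def)
qed

text \<open>
  The summand \<open>p\<close> is the proximal point of \<open>d\<close> for \<open>\<phi>\<close>. A minimizer of \<open>\<phi>(t) + (d - t)\<^sup>2/2\<close> over
  \<open>{0..d}\<close> exists by compactness, and it is global: replacing \<open>t > d\<close> by \<open>d\<close> or \<open>t < 0\<close> by \<open>0\<close>
  increases neither term, as \<open>\<phi>\<close> is least at \<open>0\<close> and nondecreasing on the nonnegative half-line.
\<close>

lemma even_convex_decomposition:
  fixes \<phi> :: "real \<Rightarrow> real"
  assumes even: "\<And>t. \<phi> (- t) = \<phi> t" and conv: "convex_on UNIV \<phi>" and "0 \<le> d"
  obtains u p where "u \<in> subdifferential \<phi> p" and "0 \<le> u" and "0 \<le> p" and "d = u + p"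
proof -
  define h where "h t = \<phi> t + (norm (d - t))\<^sup>2 / 2" for t
  have "continuous_on UNIV \<phi>"
    using convex_on_continuous[OF open_UNIV conv] .
  then have "continuous_on {0..d} h"
    unfolding h_def using continuous_on_subset by (intro continuous_intros) auto
  then obtain p where p: "p \<in> {0..d}" and min: "\<And>t. t \<in> {0..d} \<Longrightarrow> h p \<le> h t"
    using continuous_attains_inf[of "{0..d}" h] \<open>0 \<le> d\<close> by auto
  have "h p \<le> h t" for t
  proof -
    consider "t < 0" | "t \<in> {0..d}" | "d < t"
      by fastforce
    then show ?thesis
    proof cases
      case 1
      then have "d\<^sup>2 \<le> (d - t)\<^sup>2"
        using \<open>0 \<le> d\<close> by (intro power_mono) auto
      then have "h 0 \<le> h t"
        using even_convex_zero_le[OF even conv, of t] by (simp add: h_def)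
      then show ?thesis
        using min[of 0] \<open>0 \<le> d\<close> by simp
    next
      case 2
      then show ?thesis
        by (rule min)
    next
      case 3
      \<comment> \<open>\<open>d\<close> is the convex combination of \<open>0\<close> and \<open>t\<close> with weight \<open>d / t\<close> on \<open>t\<close>.\<close>
      have "\<phi> d \<le> (1 - d / t) * \<phi> 0 + (d / t) * \<phi> t"
        using convex_onD[OF conv, of "d / t" 0 t] 3 \<open>0 \<le> d\<close> by simp
      also have "\<dots> \<le> (1 - d / t) * \<phi> t + (d / t) * \<phi> t"
        using 3 \<open>0 \<le> d\<close> even_convex_zero_le[OF even conv, of t]
        by (intro add_right_mono mult_left_mono) auto
      also have "\<dots> = \<phi> t"
        by (simp add: algebra_simps)
      finally have "\<phi> d \<le> \<phi> t" .
      then have "h d \<le> h t"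
        unfolding h_def by (intro add_mono) auto
      then show ?thesis
        using min[of d] \<open>0 \<le> d\<close> by simp
    qed
  qed
  then have "d - p \<in> subdifferential \<phi> p"
    unfolding h_def by (intro prox_minimizer_subgradient conv) auto
  then show thesis
    using p by (intro that[of "d - p" p]) auto
qed

section \<open>The proximity operator of a function of the distance\<close>

theorem proposition2p7:
  fixes C :: "'a::{real_inner, complete_space} set"
    and \<phi> :: "real \<Rightarrow> real"
    and f :: "'a \<Rightarrow> real"
    and x :: 'a
  assumes "C \<noteq> {}" and "closed C" and "convex C"
    and "\<And>t. \<phi> (- t) = \<phi> t"
    and "convex_on UNIV \<phi>"
    and "\<And>t. t \<noteq> 0 \<Longrightarrow> \<phi> differentiable (at t)"
    and "f = \<phi> \<circ> (\<lambda>y. infdist y C)"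
  shows "prox (\<lambda>y. ereal (f y)) x =
    (if infdist x C > (GREATEST u. u \<in> subdifferential \<phi> 0)
     then x + (prox (convex_conjugate \<phi>) (infdist x C) / infdist x C) *\<^sub>R (projection C x - x)
     else projection C x)"
proof (cases "infdist x C > (GREATEST u. u \<in> subdifferential \<phi> 0)")
  case True
  obtain u p where up: "u \<in> subdifferential \<phi> p" "0 \<le> u" "0 \<le> p" "infdist x C = u + p"
    using even_convex_decomposition[OF assms(4,5) infdist_nonneg] .
  have "prox (convex_conjugate \<phi>) (infdist x C) = u"
    using prox_convex_conjugate[OF up(1)] up(4) by simp
  then show ?thesis
    using prox_comp_infdist[OF assms(1-3) up] True by (simp add: assms(7))
next
  case False
  then have "infdist x C \<in> subdifferential \<phi> 0"
    using le_Greatest_subdifferential_zero[OF assms(4,5) infdist_nonneg, of x C] by simp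
  then have "prox (\<lambda>y. ereal (f y)) x
      = x + (infdist x C / infdist x C) *\<^sub>R (projection C x - x)"
    using prox_comp_infdist[OF assms(1-3) _ infdist_nonneg order_refl, of x C \<phi> x]
    by (simp add: assms(7))
  also have "\<dots> = projection C x"
    \<comment> \<open>If \<open>x \<in> C\<close>, the quotient is \<open>0 / 0 = 0\<close>, but then \<open>x\<close> is its own projection.\<close>
    using norm_diff_projection[OF assms(1-3), of x] by (cases "infdist x C = 0") auto
  finally show ?thesis
    using False by simp
qed

end
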